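(* Let $\{G_n\}_{n\ge1}$ be a sequence of (deterministic or random) finite simple graphs, $G_n$ on vertex set $[n]$, with $|E(G_n)|\to\infty$ in probability. Then the ACF4 condition $N(G_n,C_4)=o_P(|E(G_n)|^2)$ is equivalent to the condition that $N(G_n,C_g)=o_P(|E(G_n)|^{g/2})$ for all $g\ge3$.
   Context: $C_g$ is the cycle of length $g$, $E(G)$ is the edge set of $G$, and $N(G,H)$ is the number of (not necessarily induced) subgraphs of $G$ isomorphic to $H$. $X_n=o_P(a_n)$ means that $X_n/a_n\to0$ in probability as $n\to\infty$; for deterministic sequences this is ordinary $o(a_n)$. *)

theory Defs
  imports "HOL-Probability.Probability"
begin

type_synonym 'v graph = "'v set \<times> 'v set set"

abbreviation vertices :: "'v graph \<Rightarrow> 'v set" where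
  "vertices G \<equiv> fst G"

abbreviation edges :: "'v graph \<Rightarrow> 'v set set" where
  "edges G \<equiv> snd G"

definition simple_graph :: "'v graph \<Rightarrow> bool" where
  "simple_graph G \<longleftrightarrow> (\<forall>e\<in>edges G. e \<subseteq> vertices G \<and> card e = 2)"

definition graphs_on :: "'v set \<Rightarrow> 'v graph set" where
  "graphs_on V = {G. simple_graph G \<and> vertices G = V}"

definition is_subgraph :: "'v graph \<Rightarrow> 'v graph \<Rightarrow> bool" where
  "is_subgraph S G \<longleftrightarrow> simple_graph S \<and> vertices S \<subseteq> vertices G \<and> edges S \<subseteq> edges G"

definition graph_isomorphic :: "'v graph \<Rightarrow> 'w graph \<Rightarrow> bool" where
  "graph_isomorphic G H \<longleftrightarrow>
     (\<exists>f. bij_betw f (vertices G) (vertices H) \<and>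
          (\<forall>u\<in>vertices G. \<forall>v\<in>vertices G. {u, v} \<in> edges G \<longleftrightarrow> {f u, f v} \<in> edges H))"

definition subgraph_count :: "'v graph \<Rightarrow> 'w graph \<Rightarrow> nat" where
  "subgraph_count G H = card {S. is_subgraph S G \<and> graph_isomorphic S H}"

(* The cycle of length g on the vertices 0, ..., g - 1; it is a cycle only for g \<ge> 3. *)
definition cycle_graph :: "nat \<Rightarrow> nat graph" where
  "cycle_graph g = ({..<g}, {{i, Suc i mod g} | i. i < g})"

(* The n-th random variable lives on its own probability space M n, as nothing in the
   notions below relates different values of n. *)
definition tendsto_zero_in_prob :: "(nat \<Rightarrow> 'a measure) \<Rightarrow> (nat \<Rightarrow> 'a \<Rightarrow> real) \<Rightarrow> bool" where
  "tendsto_zero_in_prob M X \<longleftrightarrow>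
     (\<forall>\<epsilon>>0. (\<lambda>n. measure (M n) {\<omega> \<in> space (M n). \<bar>X n \<omega>\<bar> > \<epsilon>}) \<longlonglongrightarrow> 0)"

definition tendsto_infinity_in_prob :: "(nat \<Rightarrow> 'a measure) \<Rightarrow> (nat \<Rightarrow> 'a \<Rightarrow> real) \<Rightarrow> bool" where
  "tendsto_infinity_in_prob M X \<longleftrightarrow>
     (\<forall>K. (\<lambda>n. measure (M n) {\<omega> \<in> space (M n). X n \<omega> > K}) \<longlonglongrightarrow> 1)"

(* X n = o_P (a n) for random normalisers a n. The quotient is 0 where a n vanishes;
   this is immaterial when a n tends to infinity in probability. *)
definition small_oP ::
  "(nat \<Rightarrow> 'a measure) \<Rightarrow> (nat \<Rightarrow> 'a \<Rightarrow> real) \<Rightarrow> (nat \<Rightarrow> 'a \<Rightarrow> real) \<Rightarrow> bool" where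
  "small_oP M X a \<longleftrightarrow> tendsto_zero_in_prob M (\<lambda>n \<omega>. X n \<omega> / a n \<omega>)"

end

theory Submission
  imports Defs
begin

text \<open>
  One direction is the case \<open>g = 4\<close>. For the other, everything follows from a deterministic
  bound for a graph \<open>G\<close> with \<open>m\<close> edges and \<open>g \<ge> 3\<close>, \<open>g \<noteq> 4\<close>
  (lemma \<open>subgraph_count_cycle_bound\<close>):
  \[ N(G, C_g) \le 2 \sqrt{48 \, N(G, C_4) \, (2m)^{g-2}} + \sqrt{(2m)^{g-1}}. \]
  After division by $m^{g/2}$ the first term is a constant times $\sqrt{N(G, C_4) / m^2}$ and the
  second a constant times $m^{-1/2}$, so both vanish under the hypotheses.

  A purely spectral argument is not available: closed walks of length 4 are dominated by
  degenerate ones in a star, which has no cycle at all. Instead, cycles $x_0, \dots, x_{g-1}$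
  are sorted by whether $x_0$ and $x_2$ have at least two common neighbours (the pair is
  \<^emph>\<open>rich\<close>) or not (it is \<^emph>\<open>poor\<close>).

  Let $c(x, z)$ be the number of common neighbours and $W_k(x, z)$ the number of walks of length
  $k$. Cycles with $(x_0, x_2)$ rich number at most the sum of $c(x, z) W_{g-2}(z, x)$ over rich
  pairs, to which Cauchy--Schwarz applies. The sum of $c^2 \le 2 c (c - 1)$ over rich pairs is at
  most a constant times the number of 4-cycles, and the sum of $W_k^2$ over all pairs is the squared Frobenius norm
  of the $k$-th power of the adjacency matrix, hence at most $(2m)^k$.

  If $(x_0, x_2)$ is poor, $x_1$ is determined by its neighbours on the cycle. For odd \<open>g\<close> the
  other $g - 1$ vertices form a walk, which is covered by $(g - 1) / 2$ disjoint edges, so that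
  there are at most $(2m)^{(g-1)/2}$ such cycles. For even $g \ge 6$ one needs a second determined
  vertex: if $(x_3, x_5)$ is rich, the previous bound applies after a rotation, and otherwise
  $x_4$ is determined too, and the remaining $g - 2$ vertices are covered by $(g - 2) / 2$ edges.
\<close>

section \<open>Walks and their weights\<close>

definition adj :: "'v graph \<Rightarrow> 'v \<Rightarrow> 'v \<Rightarrow> bool" where
  "adj G u v \<longleftrightarrow> {u, v} \<in> edges G"

fun walk_count :: "'v graph \<Rightarrow> nat \<Rightarrow> 'v \<Rightarrow> 'v \<Rightarrow> real" where
  "walk_count G 0 u v = of_bool (u = v)"
| "walk_count G (Suc k) u v = (\<Sum>w\<in>vertices G. of_bool (adj G u w) * walk_count G k w v)"

lemma adj_sym: "adj G u v \<longleftrightarrow> adj G v u"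
  by (simp add: adj_def insert_commute)

lemma walk_count_nonneg: "0 \<le> walk_count G k u v"
  by (induction k arbitrary: u) (auto intro!: sum_nonneg)

locale finite_simple_graph =
  fixes G :: "'v graph"
  assumes finite_vertices: "finite (vertices G)"
    and simple: "simple_graph G"
begin

lemma adj_vertices:
  assumes "adj G u v"
  shows "u \<in> vertices G" "v \<in> vertices G"
  using assms simple by (auto simp: adj_def simple_graph_def)

lemma adj_neq: "adj G u v \<Longrightarrow> u \<noteq> v"
  using simple by (auto simp: adj_def simple_graph_def)

lemma finite_edges: "finite (edges G)"
  using finite_vertices simple finite_subset[of "edges G" "Pow (vertices G)"]
  by (auto simp: simple_graph_def)

lemma sum_adj_le:
  "(\<Sum>u\<in>vertices G. \<Sum>v\<in>vertices G. of_bool (adj G u v)) \<le> 2 * real (card (edges G))"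
proof -
  have fib: "card {(u, v). {u, v} = e} \<le> 2" if e: "e \<in> edges G" for e
  proof -
    obtain a b where "e = {a, b}"
      using e simple by (meson simple_graph_def card_2_iff)
    then have "{(u, v). {u, v} = e} \<subseteq> set [(a, b), (b, a)]"
      by (auto simp: doubleton_eq_iff)
    from card_mono[OF _ this] show ?thesis
      using card_length[of "[(a, b), (b, a)]"] by simp
  qed
  have "(\<Sum>u\<in>vertices G. \<Sum>v\<in>vertices G. of_bool (adj G u v) :: real)
      = (\<Sum>(u, v)\<in>vertices G \<times> vertices G. of_bool (adj G u v))"
    by (rule sum.cartesian_product)
  also have "\<dots> = real (card {(u, v). adj G u v})"
    using finite_vertices adj_vertices
    by (auto simp: of_bool_def case_prod_beta sum.If_cases intro!: arg_cong[where f = card])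
  also have "{(u, v). adj G u v} = (\<Union>e\<in>edges G. {(u, v). {u, v} = e})"
    by (auto simp: adj_def)
  also have "card \<dots> \<le> (\<Sum>e\<in>edges G. card {(u, v). {u, v} = e})"
    by (rule card_UN_le[OF finite_edges])
  also have "\<dots> \<le> (\<Sum>e\<in>edges G. 2)"
    by (rule sum_mono) (rule fib)
  finally show ?thesis by simp
qed

lemma walk_count_1: "v \<in> vertices G \<Longrightarrow> walk_count G (Suc 0) u v = of_bool (adj G u v)"
  using finite_vertices by simp

text \<open>
  This is submultiplicativity of the Frobenius norm for powers of the adjacency matrix, whose own
  squared norm is twice the number of edges.
\<close>
lemma sum_walk_count_squares_le:
  "(\<Sum>u\<in>vertices G. \<Sum>v\<in>vertices G. (walk_count G (Suc k) u v)\<^sup>2) \<le> (2 * real (card (edges G))) ^ Suc k"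
proof (induction k)
  case 0
  have "(\<Sum>u\<in>vertices G. \<Sum>v\<in>vertices G. (walk_count G (Suc 0) u v)\<^sup>2)
      = (\<Sum>u\<in>vertices G. \<Sum>v\<in>vertices G. of_bool (adj G u v))"
    by (intro sum.cong refl) (simp only: walk_count_1, simp)
  then show ?case using sum_adj_le by simp
next
  case (Suc k)
  let ?V = "vertices G" and ?W = "walk_count G (Suc k)" and ?m = "real (card (edges G))"
  have sq: "(of_bool b)\<^sup>2 = (of_bool b :: real)" for b by (cases b) auto
  have "(\<Sum>u\<in>?V. \<Sum>v\<in>?V. (walk_count G (Suc (Suc k)) u v)\<^sup>2)
      = (\<Sum>u\<in>?V. \<Sum>v\<in>?V. (\<Sum>w\<in>?V. of_bool (adj G u w) * ?W w v)\<^sup>2)"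
    by (subst walk_count.simps(2)) simp
  also have "\<dots> \<le> (\<Sum>u\<in>?V. \<Sum>v\<in>?V. (\<Sum>w\<in>?V. (of_bool (adj G u w))\<^sup>2) * (\<Sum>w\<in>?V. (?W w v)\<^sup>2))"
    by (intro sum_mono Cauchy_Schwarz_ineq_sum)
  also have "\<dots> = (\<Sum>u\<in>?V. \<Sum>w\<in>?V. (of_bool (adj G u w))\<^sup>2) * (\<Sum>v\<in>?V. \<Sum>w\<in>?V. (?W w v)\<^sup>2)"
    by (simp only: sum_product)
  also have "\<dots> = (\<Sum>u\<in>?V. \<Sum>w\<in>?V. of_bool (adj G u w)) * (\<Sum>w\<in>?V. \<Sum>v\<in>?V. (?W w v)\<^sup>2)"
    by (subst sum.swap[of "\<lambda>v w. (?W w v)\<^sup>2"]) (simp only: sq)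
  also have "\<dots> \<le> (2 * ?m) * (2 * ?m) ^ Suc k"
    by (intro mult_mono sum_adj_le Suc.IH sum_nonneg) auto
  finally show ?case by simp
qed

text \<open>
  A walk of odd length has an even number of vertices, and every other one of its edges already
  visits all of them.
\<close>
lemma sum_odd_walk_count_le:
  "(\<Sum>u\<in>vertices G. \<Sum>v\<in>vertices G. walk_count G (Suc (2 * j)) u v) \<le> (2 * real (card (edges G))) ^ Suc j"
proof (induction j)
  case 0
  have "(\<Sum>u\<in>vertices G. \<Sum>v\<in>vertices G. walk_count G (Suc 0) u v)
      = (\<Sum>u\<in>vertices G. \<Sum>v\<in>vertices G. of_bool (adj G u v))"
    by (intro sum.cong refl) (simp only: walk_count_1)
  then show ?case using sum_adj_le by simp
next
  case (Suc j)
  let ?V = "vertices G" and ?W = "walk_count G (Suc (2 * j))" and ?m = "real (card (edges G))"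
  let ?A = "\<lambda>u v. of_bool (adj G u v) :: real"
  have step: "walk_count G (Suc (2 * Suc j)) u v \<le> (\<Sum>x\<in>?V. ?A u x) * (\<Sum>y\<in>?V. ?W y v)" for u v
  proof -
    have "walk_count G (Suc (2 * Suc j)) u v = walk_count G (Suc (Suc (Suc (2 * j)))) u v" by simp
    also have "\<dots> = (\<Sum>x\<in>?V. ?A u x * (\<Sum>y\<in>?V. ?A x y * ?W y v))"
      by (subst walk_count.simps(2), subst walk_count.simps(2)) (rule refl)
    also have "\<dots> \<le> (\<Sum>x\<in>?V. ?A u x * (\<Sum>y\<in>?V. 1 * ?W y v))"
      by (intro sum_mono mult_left_mono mult_right_mono walk_count_nonneg) auto
    also have "\<dots> = (\<Sum>x\<in>?V. ?A u x) * (\<Sum>y\<in>?V. ?W y v)"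
      by (simp only: sum_distrib_right mult_1)
    finally show ?thesis .
  qed
  have "(\<Sum>u\<in>?V. \<Sum>v\<in>?V. walk_count G (Suc (2 * Suc j)) u v)
      \<le> (\<Sum>u\<in>?V. \<Sum>v\<in>?V. (\<Sum>x\<in>?V. ?A u x) * (\<Sum>y\<in>?V. ?W y v))"
    by (intro sum_mono step)
  also have "\<dots> = (\<Sum>u\<in>?V. \<Sum>x\<in>?V. ?A u x) * (\<Sum>v\<in>?V. \<Sum>y\<in>?V. ?W y v)"
    by (simp only: sum_product)
  also have "\<dots> = (\<Sum>u\<in>?V. \<Sum>x\<in>?V. ?A u x) * (\<Sum>y\<in>?V. \<Sum>v\<in>?V. ?W y v)"
    by (subst sum.swap[of "\<lambda>v w. ?W w v"]) (rule refl)
  also have "\<dots> \<le> (2 * ?m) * (2 * ?m) ^ Suc j"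
    by (intro mult_mono sum_adj_le Suc.IH sum_nonneg walk_count_nonneg) auto
  finally show ?case by simp
qed

text \<open>
  A walk from \<open>u\<close> to \<open>v\<close> is represented by its interior vertices only, so that walks with
  \<open>k\<close> interior vertices have length \<open>k + 1\<close>.
\<close>
definition inner_walks :: "nat \<Rightarrow> 'v \<Rightarrow> 'v \<Rightarrow> 'v list set" where
  "inner_walks k u v = {ws. length ws = k \<and> successively (adj G) (u # ws @ [v])}"

lemma inner_walks_Suc:
  "inner_walks (Suc k) u v
    = (\<lambda>(w, ws). w # ws) ` (SIGMA w:{w \<in> vertices G. adj G u w}. inner_walks k w v)"
  using adj_vertices(2) by (force simp: inner_walks_def length_Suc_conv image_iff)

lemma finite_inner_walks: "finite (inner_walks k u v)"
proof (induction k arbitrary: u)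
  case 0
  show ?case by (simp add: inner_walks_def)
next
  case (Suc k)
  then show ?case
    using finite_vertices by (simp add: inner_walks_Suc)
qed

lemma card_inner_walks:
  assumes "v \<in> vertices G"
  shows "real (card (inner_walks k u v)) = walk_count G (Suc k) u v"
proof (induction k arbitrary: u)
  case 0
  have "inner_walks 0 u v = (if adj G u v then {[]} else {})"
    by (auto simp: inner_walks_def)
  then show ?case by (simp only: walk_count_1[OF assms]) simp
next
  case (Suc k)
  have "real (card (inner_walks (Suc k) u v))
      = real (card (SIGMA w:{w \<in> vertices G. adj G u w}. inner_walks k w v))"
    unfolding inner_walks_Suc by (subst card_image) (auto simp: inj_on_def)
  also have "\<dots> = (\<Sum>w\<in>{w \<in> vertices G. adj G u w}. walk_count G (Suc k) w v)"
    using finite_vertices finite_inner_walks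
    by (subst card_SigmaI) (auto simp: Suc.IH simp del: walk_count.simps)
  also have "\<dots> = (\<Sum>w\<in>vertices G. of_bool (adj G u w) * walk_count G (Suc k) w v)"
    using finite_vertices
    by (simp add: sum.inter_filter of_bool_def if_distrib[of "\<lambda>x. x * _"]
             del: walk_count.simps cong: if_cong)
  finally show ?case by (subst walk_count.simps(2))
qed

end

section \<open>Cycles as lists of vertices\<close>

definition list_cycle :: "'v list \<Rightarrow> 'v graph" where
  "list_cycle xs = (set xs, {{xs ! i, xs ! (Suc i mod length xs)} | i. i < length xs})"

text \<open>
  These are labelled cycles: for \<open>g \<ge> 3\<close>, each \<open>g\<close>-cycle occurs once for every choice of a starting point and
  a direction.
\<close>
definition cycle_lists :: "'v graph \<Rightarrow> nat \<Rightarrow> 'v list set" where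
  "cycle_lists G g = {xs. length xs = g \<and> distinct xs \<and> successively (adj G) (xs @ [hd xs])}"

lemma successively_conv_nth:
  "successively P xs \<longleftrightarrow> (\<forall>i. Suc i < length xs \<longrightarrow> P (xs ! i) (xs ! Suc i))"
  by (induction xs rule: induct_list012) (auto simp: nth_Cons split: nat.splits)

lemma successively_closed_iff:
  assumes "xs \<noteq> []"
  shows "successively P (xs @ [hd xs]) \<longleftrightarrow>
           (\<forall>i<length xs. P (xs ! i) (xs ! (Suc i mod length xs)))"
proof -
  have "(xs @ [hd xs]) ! Suc i = xs ! (Suc i mod length xs)" if "i < length xs" for i
    using that assms by (cases "Suc i = length xs") (auto simp: nth_append hd_conv_nth)
  then show ?thesis
    by (auto simp: successively_conv_nth nth_append)
qed

lemma list_cycle_edge_iff: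
  assumes "distinct xs" "i < length xs" "j < length xs"
  shows "{xs ! i, xs ! j} \<in> edges (list_cycle xs) \<longleftrightarrow> {i, j} \<in> edges (cycle_graph (length xs))"
proof -
  have "{xs ! i, xs ! j} = {xs ! k, xs ! (Suc k mod length xs)} \<longleftrightarrow> {i, j} = {k, Suc k mod length xs}"
    if "k < length xs" for k
  proof -
    have "Suc k mod length xs < length xs" using that by (intro mod_less_divisor) auto
    then show ?thesis
      using assms that by (auto simp: doubleton_eq_iff nth_eq_iff_index_eq)
  qed
  then show ?thesis
    by (auto simp: list_cycle_def cycle_graph_def)
qed

lemma graph_isomorphic_list_cycle:
  assumes "distinct xs"
  shows "graph_isomorphic (list_cycle xs) (cycle_graph (length xs))"
proof -
  let ?f = "inv_into {..<length xs} ((!) xs)"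
  have bij: "bij_betw ((!) xs) {..<length xs} (set xs)"
    using assms by (rule bij_betw_nth) auto
  have f: "?f (xs ! i) = i" if "i < length xs" for i
    using bij that by (auto simp: bij_betw_def intro: inv_into_f_f)
  have "{u, v} \<in> edges (list_cycle xs) \<longleftrightarrow> {?f u, ?f v} \<in> edges (cycle_graph (length xs))"
    if "u \<in> set xs" "v \<in> set xs" for u v
    using that list_cycle_edge_iff[OF assms] by (auto simp: in_set_conv_nth f)
  then show ?thesis
    using bij_betw_inv_into[OF bij]
    by (auto simp: graph_isomorphic_def list_cycle_def cycle_graph_def intro!: exI[of _ ?f])
qed

lemma isomorphic_to_cycle_is_list_cycle:
  assumes "simple_graph S" "graph_isomorphic S (cycle_graph g)"
  obtains xs where "length xs = g" "distinct xs" "S = list_cycle xs"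
proof -
  obtain f where f: "bij_betw f (vertices S) {..<g}"
    and iso: "\<And>u v. u \<in> vertices S \<Longrightarrow> v \<in> vertices S \<Longrightarrow>
                {u, v} \<in> edges S \<longleftrightarrow> {f u, f v} \<in> edges (cycle_graph g)"
    using assms(2) by (auto simp: graph_isomorphic_def cycle_graph_def)
  define h where "h = inv_into (vertices S) f"
  have h: "bij_betw h {..<g} (vertices S)"
    unfolding h_def by (rule bij_betw_inv_into[OF f])
  have fh: "f (h i) = i" if "i < g" for i
    using f that by (auto simp: h_def bij_betw_def intro: f_inv_into_f)
  define xs where "xs = map h [0..<g]"
  have len: "length xs = g" and nth: "\<And>i. i < g \<Longrightarrow> xs ! i = h i"
    by (auto simp: xs_def)
  have set_xs: "set xs = vertices S"
    using h by (auto simp: xs_def bij_betw_def atLeast0LessThan)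
  have dist: "distinct xs"
    using h by (auto simp: xs_def distinct_map bij_betw_def atLeast0LessThan)
  have edge_iff: "{u, v} \<in> edges S \<longleftrightarrow> {u, v} \<in> edges (list_cycle xs)"
    if uv: "u \<in> set xs" "v \<in> set xs" for u v
  proof -
    obtain i j where ij: "i < g" "j < g" "u = xs ! i" "v = xs ! j"
      using uv by (metis in_set_conv_nth len)
    then have "u \<in> vertices S" "v \<in> vertices S" using uv set_xs by auto
    from iso[OF this] show ?thesis
      using list_cycle_edge_iff[OF dist, of i j] ij by (simp add: len nth fh)
  qed
  have pairS: "\<exists>u v. e = {u, v} \<and> u \<in> set xs \<and> v \<in> set xs" if "e \<in> edges S" for e
    using that assms(1) by (fastforce simp: simple_graph_def card_2_iff set_xs)
  have pairC: "\<exists>u v. e = {u, v} \<and> u \<in> set xs \<and> v \<in> set xs" if e: "e \<in> edges (list_cycle xs)" for e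
  proof -
    obtain i where i: "i < length xs" "e = {xs ! i, xs ! (Suc i mod length xs)}"
      using e by (auto simp: list_cycle_def)
    moreover have "Suc i mod length xs < length xs" using i by (intro mod_less_divisor) auto
    ultimately show ?thesis using nth_mem by blast
  qed
  have "edges S = edges (list_cycle xs)"
    using pairS pairC edge_iff by blast
  moreover have "vertices S = vertices (list_cycle xs)"
    by (simp add: list_cycle_def set_xs)
  ultimately show thesis
    using that[OF len dist] by (simp add: prod_eq_iff)
qed

lemma rotate_cycle_lists: "xs \<in> cycle_lists G g \<Longrightarrow> rotate k xs \<in> cycle_lists G g"
proof (induction k)
  case (Suc k)
  have "rotate1 ys \<in> cycle_lists G g" if "ys \<in> cycle_lists G g" for ys
    using that
    by (cases ys) (auto simp: cycle_lists_def successively_append_iff successively_Cons hd_append)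
  with Suc show ?case by simp
qed simp

context finite_simple_graph
begin

lemma cycle_lists_vertices:
  assumes "xs \<in> cycle_lists G g"
  shows "set xs \<subseteq> vertices G"
proof
  fix x assume "x \<in> set xs"
  then obtain i where "i < length xs" "x = xs ! i" by (auto simp: in_set_conv_nth)
  moreover from this have "xs \<noteq> []" by auto
  ultimately show "x \<in> vertices G"
    using assms adj_vertices(1) by (auto simp: cycle_lists_def successively_closed_iff)
qed

lemma finite_cycle_lists: "finite (cycle_lists G g)"
  by (rule finite_subset[OF _ finite_lists_length_eq[OF finite_vertices, of g]])
     (use cycle_lists_vertices in \<open>auto simp: cycle_lists_def\<close>)

lemma list_cycle_is_subgraph_iff:
  assumes "distinct xs" "xs \<noteq> []"
  shows "is_subgraph (list_cycle xs) G \<longleftrightarrow> xs \<in> cycle_lists G (length xs)"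
proof
  assume "is_subgraph (list_cycle xs) G"
  then show "xs \<in> cycle_lists G (length xs)"
    using assms
    by (auto simp: is_subgraph_def cycle_lists_def successively_closed_iff adj_def list_cycle_def)
next
  assume xs: "xs \<in> cycle_lists G (length xs)"
  have "Suc i mod length xs < length xs" if "i < length xs" for i
    using that by (intro mod_less_divisor) auto
  moreover have sub: "edges (list_cycle xs) \<subseteq> edges G"
    using xs assms
    by (auto simp: cycle_lists_def successively_closed_iff adj_def list_cycle_def)
  moreover have "\<forall>e\<in>edges (list_cycle xs). card e = 2"
    using sub simple by (auto simp: simple_graph_def)
  ultimately show "is_subgraph (list_cycle xs) G"
    using cycle_lists_vertices[OF xs]
    by (auto simp: is_subgraph_def simple_graph_def list_cycle_def)
qed

lemma subgraph_count_cycle: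
  assumes "g > 0"
  shows "subgraph_count G (cycle_graph g) = card (list_cycle ` cycle_lists G g)"
proof -
  have "{S. is_subgraph S G \<and> graph_isomorphic S (cycle_graph g)} = list_cycle ` cycle_lists G g"
  proof (intro equalityI subsetI)
    fix S assume "S \<in> {S. is_subgraph S G \<and> graph_isomorphic S (cycle_graph g)}"
    then have S: "is_subgraph S G" "simple_graph S" "graph_isomorphic S (cycle_graph g)"
      by (auto simp: is_subgraph_def)
    obtain xs where xs: "length xs = g" "distinct xs" "S = list_cycle xs"
      using isomorphic_to_cycle_is_list_cycle[OF S(2,3)] .
    then show "S \<in> list_cycle ` cycle_lists G g"
      using list_cycle_is_subgraph_iff[of xs] S(1) assms by auto
  next
    fix S assume "S \<in> list_cycle ` cycle_lists G g"
    then obtain xs where xs: "xs \<in> cycle_lists G g" "S = list_cycle xs" by auto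
    then have "length xs = g" "distinct xs" by (auto simp: cycle_lists_def)
    then show "S \<in> {S. is_subgraph S G \<and> graph_isomorphic S (cycle_graph g)}"
      using list_cycle_is_subgraph_iff[of xs] graph_isomorphic_list_cycle[of xs] xs assms by auto
  qed
  then show ?thesis by (simp add: subgraph_count_def)
qed

text \<open>
  Labelled cycles overcount subgraphs by a bounded factor. For an upper bound on long cycles the
  overcounting is harmless, and for 4-cycles, where a lower bound on the number of subgraphs is
  needed, the crude factor 4! from the orderings of the vertex set suffices.
\<close>
lemma subgraph_count_cycle_le:
  "g > 0 \<Longrightarrow> subgraph_count G (cycle_graph g) \<le> card (cycle_lists G g)"
  by (simp add: subgraph_count_cycle card_image_le finite_cycle_lists)

lemma card_cycle_lists_4_le:
  "card (cycle_lists G 4) \<le> 24 * subgraph_count G (cycle_graph 4)"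
proof -
  let ?F = "\<lambda>S. {xs \<in> cycle_lists G 4. list_cycle xs = S}"
  have fib: "card (?F S) \<le> 24" if S: "S \<in> list_cycle ` cycle_lists G 4" for S
  proof -
    obtain ys where ys: "ys \<in> cycle_lists G 4" "S = list_cycle ys" using S by blast
    then have "card (vertices S) = 4"
      by (auto simp: cycle_lists_def list_cycle_def distinct_card)
    moreover from this have fin: "finite (vertices S)" by (intro card_ge_0_finite) simp
    ultimately have lists: "card {xs. length xs = 4 \<and> distinct xs \<and> set xs \<subseteq> vertices S} = \<Prod>{1..4}"
      by (subst card_lists_distinct_length_eq) auto
    have "card (?F S) \<le> card {xs. length xs = 4 \<and> distinct xs \<and> set xs \<subseteq> vertices S}"
    proof (rule card_mono)
      show "finite {xs. length xs = 4 \<and> distinct xs \<and> set xs \<subseteq> vertices S}"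
        by (rule finite_subset[OF _ finite_lists_length_eq[OF fin, of 4]]) auto
    qed (auto simp: cycle_lists_def list_cycle_def)
    also have "\<dots> = 24"
      unfolding lists by (simp add: eval_nat_numeral atLeastAtMostSuc_conv)
    finally show ?thesis .
  qed
  have "cycle_lists G 4 = (\<Union>S\<in>list_cycle ` cycle_lists G 4. ?F S)" by auto
  then have "card (cycle_lists G 4) = card (\<Union>S\<in>list_cycle ` cycle_lists G 4. ?F S)"
    by (rule arg_cong)
  also have "\<dots> \<le> (\<Sum>S\<in>list_cycle ` cycle_lists G 4. card (?F S))"
    by (intro card_UN_le finite_imageI finite_cycle_lists)
  also have "\<dots> \<le> card (list_cycle ` cycle_lists G 4) * 24"
    using sum_bounded_above[OF fib] by simp
  finally show ?thesis by (simp add: subgraph_count_cycle)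
qed

end

section \<open>Counting cycles through codegrees\<close>

context finite_simple_graph
begin

definition common_nbrs :: "'v \<Rightarrow> 'v \<Rightarrow> 'v set" where
  "common_nbrs x z = {y. adj G x y \<and> adj G y z}"

definition rich_pairs :: "('v \<times> 'v) set" where
  "rich_pairs = {(x, z) \<in> vertices G \<times> vertices G. x \<noteq> z \<and> 2 \<le> card (common_nbrs x z)}"

text \<open>
  The pair of vertices at distance two is \<open>i\<close> and \<open>i + 2\<close> without reduction modulo \<open>g\<close>; only
  \<open>i = 0\<close> and \<open>i = 3\<close> with \<open>i + 2 < g\<close> occur.
\<close>
definition rich_cycle_lists :: "nat \<Rightarrow> nat \<Rightarrow> 'v list set" where
  "rich_cycle_lists i g = {xs \<in> cycle_lists G g. 2 \<le> card (common_nbrs (xs ! i) (xs ! (i + 2)))}"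

lemma finite_common_nbrs: "finite (common_nbrs x z)"
  using finite_vertices
  by (rule finite_subset[rotated]) (auto simp: common_nbrs_def dest: adj_vertices)

lemma finite_rich_pairs: "finite rich_pairs"
  by (rule finite_subset[of _ "vertices G \<times> vertices G"])
     (auto simp: rich_pairs_def finite_vertices)

text \<open>
  Two distinct common neighbours \<open>y\<close>, \<open>w\<close> of \<open>x\<close> and \<open>z\<close> span the 4-cycle \<open>x, y, z, w\<close>.
\<close>
lemma sum_rich_codegree_le:
  "(\<Sum>(x, z)\<in>rich_pairs. card (common_nbrs x z) * (card (common_nbrs x z) - 1)) \<le> card (cycle_lists G 4)"
proof -
  let ?N = "\<lambda>p. common_nbrs (fst p) (snd p)"
  let ?S = "SIGMA p:rich_pairs. SIGMA y:?N p. ?N p - {y}"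
  have fin: "finite (SIGMA y:?N p. ?N p - {y})" for p
    by (intro finite_SigmaI) (auto simp: finite_common_nbrs)
  have "(\<Sum>(x, z)\<in>rich_pairs. card (common_nbrs x z) * (card (common_nbrs x z) - 1))
      = (\<Sum>p\<in>rich_pairs. card (SIGMA y:?N p. ?N p - {y}))"
    by (intro sum.cong refl) (auto simp: card_SigmaI finite_common_nbrs)
  also have "\<dots> = card ?S"
    using fin by (simp add: card_SigmaI finite_rich_pairs)
  also have "\<dots> \<le> card (cycle_lists G 4)"
  proof (rule card_inj_on_le[OF _ _ finite_cycle_lists])
    show "inj_on (\<lambda>((x, z), y, w). [x, y, z, w]) ?S"
      by (auto simp: inj_on_def)
    show "(\<lambda>((x, z), y, w). [x, y, z, w]) ` ?S \<subseteq> cycle_lists G 4"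
      using adj_sym[of G] adj_neq
      by (auto simp: cycle_lists_def common_nbrs_def rich_pairs_def)
  qed
  finally show ?thesis .
qed

text \<open>
  This is where poor pairs have to be excluded: $c^2 \le 2 c (c - 1)$ fails for $c = 1$, and in a
  star the sum of $c^2$ over all pairs is of order $m^2$ although there is no 4-cycle.
\<close>
lemma sum_rich_codegree_squares_le:
  "(\<Sum>(x, z)\<in>rich_pairs. (real (card (common_nbrs x z)))\<^sup>2)
     \<le> 48 * real (subgraph_count G (cycle_graph 4))"
proof -
  have sq: "c\<^sup>2 \<le> 2 * (c * (c - 1))" if c: "2 \<le> c" for c :: nat
  proof -
    obtain d where "c = 2 + d" using le_Suc_ex[OF c] by blast
    then show ?thesis by (simp add: power2_eq_square algebra_simps)
  qed
  have "(\<Sum>(x, z)\<in>rich_pairs. (card (common_nbrs x z))\<^sup>2)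
      \<le> (\<Sum>(x, z)\<in>rich_pairs. 2 * (card (common_nbrs x z) * (card (common_nbrs x z) - 1)))"
    by (intro sum_mono) (auto simp: rich_pairs_def intro!: sq[unfolded One_nat_def])
  also have "\<dots> = 2 * (\<Sum>(x, z)\<in>rich_pairs. card (common_nbrs x z) * (card (common_nbrs x z) - 1))"
    by (simp add: sum_distrib_left case_prod_beta)
  also have "\<dots> \<le> 48 * subgraph_count G (cycle_graph 4)"
    using sum_rich_codegree_le card_cycle_lists_4_le by linarith
  finally have "real (\<Sum>(x, z)\<in>rich_pairs. (card (common_nbrs x z))\<^sup>2)
      \<le> real (48 * subgraph_count G (cycle_graph 4))"
    by (rule of_nat_mono)
  then show ?thesis by (simp add: case_prod_beta)
qed

text \<open>
  A labelled cycle consists of the pair $(x_0, x_2)$, a common neighbour of it, and a walk of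
  length $g - 2$ that leads back from $x_2$ to $x_0$. Cauchy--Schwarz separates the two factors.
\<close>
lemma card_rich_cycle_lists_0_le:
  assumes "g \<ge> 3"
  shows "real (card (rich_cycle_lists 0 g))
    \<le> sqrt (48 * real (subgraph_count G (cycle_graph 4)) * (2 * real (card (edges G))) ^ (g - 2))"
proof -
  have len: "Suc (g - 3) = g - 2" using assms by simp
  let ?c = "\<lambda>p. real (card (common_nbrs (fst p) (snd p)))"
  let ?W = "\<lambda>p. walk_count G (g - 2) (snd p) (fst p)"
  let ?S = "SIGMA p:rich_pairs. common_nbrs (fst p) (snd p) \<times> inner_walks (g - 3) (snd p) (fst p)"
  let ?V = "vertices G"
  have "card (rich_cycle_lists 0 g) \<le> card ((\<lambda>((x, z), y, ws). x # y # z # ws) ` ?S)"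
  proof (rule card_mono)
    show "finite ((\<lambda>((x, z), y, ws). x # y # z # ws) ` ?S)"
      by (intro finite_imageI finite_SigmaI finite_rich_pairs finite_cartesian_product
            finite_common_nbrs finite_inner_walks)
    show "rich_cycle_lists 0 g \<subseteq> (\<lambda>((x, z), y, ws). x # y # z # ws) ` ?S"
    proof
      fix xs assume xs: "xs \<in> rich_cycle_lists 0 g"
      then have len: "length xs = Suc (Suc (Suc (g - 3)))"
        using assms by (auto simp: rich_cycle_lists_def cycle_lists_def)
      then obtain x y z ws where eq: "xs = x # y # z # ws" "length ws = g - 3"
        by (auto simp: length_Suc_conv)
      then have "((x, z), y, ws) \<in> ?S"
        using xs cycle_lists_vertices[of xs g]
        by (auto simp: rich_cycle_lists_def cycle_lists_def rich_pairs_def common_nbrs_def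
              inner_walks_def)
      then show "xs \<in> (\<lambda>((x, z), y, ws). x # y # z # ws) ` ?S"
        using eq by force
    qed
  qed
  also have "\<dots> \<le> card ?S"
    by (intro card_image_le finite_SigmaI finite_rich_pairs finite_cartesian_product
          finite_common_nbrs finite_inner_walks)
  also have "\<dots> = (\<Sum>p\<in>rich_pairs. card (common_nbrs (fst p) (snd p)) *
                      card (inner_walks (g - 3) (snd p) (fst p)))"
    by (simp add: card_SigmaI finite_rich_pairs finite_common_nbrs finite_inner_walks
          card_cartesian_product)
  finally have "real (card (rich_cycle_lists 0 g)) \<le> (\<Sum>p\<in>rich_pairs. ?c p *
                      real (card (inner_walks (g - 3) (snd p) (fst p))))"
    by (simp only: of_nat_mult[symmetric] of_nat_sum[symmetric] of_nat_le_iff)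
  also have "\<dots> = (\<Sum>p\<in>rich_pairs. ?c p * ?W p)"
  proof (rule sum.cong[OF refl])
    fix p assume "p \<in> rich_pairs"
    then have "fst p \<in> ?V" by (auto simp: rich_pairs_def)
    then show "?c p * real (card (inner_walks (g - 3) (snd p) (fst p))) = ?c p * ?W p"
      by (simp only: card_inner_walks len)
  qed
  finally have le: "real (card (rich_cycle_lists 0 g)) \<le> (\<Sum>p\<in>rich_pairs. ?c p * ?W p)" .
  have "(\<Sum>p\<in>rich_pairs. (?W p)\<^sup>2) \<le> (\<Sum>p\<in>?V \<times> ?V. (?W p)\<^sup>2)"
    by (rule sum_mono2) (auto simp: rich_pairs_def finite_vertices)
  also have "\<dots> = (\<Sum>x\<in>?V. \<Sum>z\<in>?V. (walk_count G (g - 2) z x)\<^sup>2)"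
    by (simp add: sum.cartesian_product case_prod_beta)
  also have "\<dots> = (\<Sum>z\<in>?V. \<Sum>x\<in>?V. (walk_count G (g - 2) z x)\<^sup>2)"
    by (rule sum.swap)
  also have "\<dots> \<le> (2 * real (card (edges G))) ^ (g - 2)"
    using sum_walk_count_squares_le[of "g - 3"] len by (simp only:)
  finally have W: "(\<Sum>p\<in>rich_pairs. (?W p)\<^sup>2) \<le> (2 * real (card (edges G))) ^ (g - 2)" .
  have "(\<Sum>p\<in>rich_pairs. ?c p * ?W p)\<^sup>2 \<le> (\<Sum>p\<in>rich_pairs. (?c p)\<^sup>2) * (\<Sum>p\<in>rich_pairs. (?W p)\<^sup>2)"
    by (rule Cauchy_Schwarz_ineq_sum)
  also have "\<dots> \<le> 48 * real (subgraph_count G (cycle_graph 4)) * (2 * real (card (edges G))) ^ (g - 2)"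
    using sum_rich_codegree_squares_le W
    by (intro mult_mono) (auto simp: case_prod_beta intro: sum_nonneg)
  finally have "(\<Sum>p\<in>rich_pairs. ?c p * ?W p)
      \<le> sqrt (48 * real (subgraph_count G (cycle_graph 4)) * (2 * real (card (edges G))) ^ (g - 2))"
    by (rule real_le_rsqrt)
  with le show ?thesis by linarith
qed

lemma card_rich_cycle_lists_3_le:
  assumes "g \<ge> 6"
  shows "card (rich_cycle_lists 3 g) \<le> card (rich_cycle_lists 0 g)"
proof (rule card_inj_on_le)
  show "inj_on (rotate 3) (rich_cycle_lists 3 g)"
    using inj_fn[OF inj_rotate1] by (auto simp: rotate_def intro: inj_on_subset)
  show "rotate 3 ` rich_cycle_lists 3 g \<subseteq> rich_cycle_lists 0 g"
  proof
    fix ys assume "ys \<in> rotate 3 ` rich_cycle_lists 3 g"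
    then obtain xs where xs: "xs \<in> rich_cycle_lists 3 g" "ys = rotate 3 xs" by blast
    then have "length xs = g" by (auto simp: rich_cycle_lists_def cycle_lists_def)
    then have "ys ! 0 = xs ! 3" "ys ! Suc (Suc 0) = xs ! 5"
      unfolding xs(2) using assms by (subst nth_rotate; simp)+
    then show "ys \<in> rich_cycle_lists 0 g"
      using xs rotate_cycle_lists[of xs G g 3] by (auto simp: rich_cycle_lists_def)
  qed
  show "finite (rich_cycle_lists 0 g)"
    using finite_cycle_lists by (auto simp: rich_cycle_lists_def)
qed

lemma common_nbr_unique:
  assumes "\<not> 2 \<le> card (common_nbrs x z)" "y \<in> common_nbrs x z" "y' \<in> common_nbrs x z"
  shows "y = y'"
proof -
  have "card (common_nbrs x z) \<le> Suc 0" using assms(1) by simp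
  then show ?thesis
    using assms(2,3) unfolding card_le_Suc0_iff_eq[OF finite_common_nbrs] by blast
qed

lemma sum_card_inner_walks_le:
  "real (\<Sum>(z, x)\<in>vertices G \<times> vertices G. card (inner_walks (2 * j) z x))
    \<le> (2 * real (card (edges G))) ^ Suc j"
proof -
  have "real (\<Sum>(z, x)\<in>vertices G \<times> vertices G. card (inner_walks (2 * j) z x))
      = (\<Sum>z\<in>vertices G. \<Sum>x\<in>vertices G. walk_count G (Suc (2 * j)) z x)"
    by (simp add: sum.cartesian_product[symmetric] card_inner_walks del: walk_count.simps)
  then show ?thesis using sum_odd_walk_count_le[of j] by simp
qed

text \<open>
  Removing the determined vertex $x_1$ is injective and leaves a walk of length $2j + 1$.
\<close>
lemma card_poor_cycle_lists_odd_le: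
  "real (card (cycle_lists G (2 * j + 3) - rich_cycle_lists 0 (2 * j + 3)))
    \<le> (2 * real (card (edges G))) ^ Suc j"
proof -
  let ?A = "cycle_lists G (2 * j + 3) - rich_cycle_lists 0 (2 * j + 3)"
  let ?S = "SIGMA (z, x):vertices G \<times> vertices G. inner_walks (2 * j) z x"
  let ?f = "\<lambda>xs. ((xs ! 2, xs ! 0), drop 3 xs)"
  have shape: "\<exists>x y z ws. xs = x # y # z # ws \<and> y \<in> common_nbrs x z \<and> \<not> 2 \<le> card (common_nbrs x z)
      \<and> x \<in> vertices G \<and> z \<in> vertices G \<and> ws \<in> inner_walks (2 * j) z x" if "xs \<in> ?A" for xs
  proof -
    have "length xs = Suc (Suc (Suc (2 * j)))"
      using that by (auto simp: cycle_lists_def)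
    then obtain x y z ws where "xs = x # y # z # ws" "length ws = 2 * j"
      by (auto simp: length_Suc_conv)
    then show ?thesis
      using that cycle_lists_vertices[of xs "2 * j + 3"]
      by (auto simp: rich_cycle_lists_def cycle_lists_def common_nbrs_def inner_walks_def)
  qed
  have "card ?A \<le> card ?S"
  proof (rule card_inj_on_le)
    show "inj_on ?f ?A"
    proof (rule inj_onI)
      fix xs xs' assume "xs \<in> ?A" "xs' \<in> ?A" and eq: "?f xs = ?f xs'"
      with shape[of xs] shape[of xs'] show "xs = xs'"
        by (auto dest: common_nbr_unique)
    qed
    show "?f ` ?A \<subseteq> ?S" using shape by fastforce
    show "finite ?S"
      using finite_vertices finite_inner_walks by auto
  qed
  also have "card ?S = (\<Sum>(z, x)\<in>vertices G \<times> vertices G. card (inner_walks (2 * j) z x))"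
    using finite_vertices finite_inner_walks by (subst card_SigmaI) (auto simp: case_prod_beta)
  finally show ?thesis
    using sum_card_inner_walks_le[of j] by (meson of_nat_mono order_trans)
qed

text \<open>
  Removing both determined vertices $x_1$ and $x_4$ is injective and leaves the edge $x_2 x_3$
  and a walk of length $2j + 1$ from $x_5$ to $x_0$.
\<close>
lemma card_poor_cycle_lists_even_le:
  "real (card (cycle_lists G (2 * j + 6) - rich_cycle_lists 0 (2 * j + 6) - rich_cycle_lists 3 (2 * j + 6)))
    \<le> (2 * real (card (edges G))) ^ (j + 2)"
proof -
  let ?A = "cycle_lists G (2 * j + 6) - rich_cycle_lists 0 (2 * j + 6) - rich_cycle_lists 3 (2 * j + 6)"
  let ?E = "SIGMA (z, x):vertices G \<times> vertices G. inner_walks 0 z x"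
  let ?S = "SIGMA (z, x):vertices G \<times> vertices G. inner_walks (2 * j) z x"
  let ?f = "\<lambda>xs. (((xs ! 2, xs ! 3), []), ((xs ! 5, xs ! 0), drop 6 xs))"
  have shape: "\<exists>x0 x1 x2 x3 x4 x5 ws. xs = x0 # x1 # x2 # x3 # x4 # x5 # ws
      \<and> x1 \<in> common_nbrs x0 x2 \<and> \<not> 2 \<le> card (common_nbrs x0 x2)
      \<and> x4 \<in> common_nbrs x3 x5 \<and> \<not> 2 \<le> card (common_nbrs x3 x5)
      \<and> ((x2, x3), []) \<in> ?E \<and> ((x5, x0), ws) \<in> ?S" if "xs \<in> ?A" for xs
  proof -
    have "length xs = Suc (Suc (Suc (Suc (Suc (Suc (2 * j))))))"
      using that by (auto simp: cycle_lists_def)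
    then obtain x0 x1 x2 x3 x4 x5 ws where "xs = x0 # x1 # x2 # x3 # x4 # x5 # ws" "length ws = 2 * j"
      by (auto simp: length_Suc_conv)
    then show ?thesis
      using that cycle_lists_vertices[of xs "2 * j + 6"]
      by (auto simp: rich_cycle_lists_def cycle_lists_def common_nbrs_def inner_walks_def)
  qed
  have fin: "finite ?E" "finite ?S"
    using finite_vertices finite_inner_walks by auto
  have "card ?A \<le> card (?E \<times> ?S)"
  proof (rule card_inj_on_le)
    show "inj_on ?f ?A"
    proof (rule inj_onI)
      fix xs xs' assume "xs \<in> ?A" "xs' \<in> ?A" and eq: "?f xs = ?f xs'"
      with shape[of xs] shape[of xs'] show "xs = xs'"
        by (auto dest: common_nbr_unique)
    qed
    show "?f ` ?A \<subseteq> ?E \<times> ?S" using shape by fastforce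
    show "finite (?E \<times> ?S)" using fin by simp
  qed
  also have "\<dots> = card ?E * card ?S" by (rule card_cartesian_product)
  finally have "real (card ?A) \<le> real (card ?E) * real (card ?S)"
    by (simp only: of_nat_mult[symmetric] of_nat_le_iff)
  also have "\<dots> \<le> (2 * real (card (edges G))) ^ Suc 0 * (2 * real (card (edges G))) ^ Suc j"
  proof (intro mult_mono)
    have card_S: "card (SIGMA (z, x):vertices G \<times> vertices G. inner_walks k z x)
        = (\<Sum>(z, x)\<in>vertices G \<times> vertices G. card (inner_walks k z x))" for k
      using finite_vertices finite_inner_walks by (subst card_SigmaI) (auto simp: case_prod_beta)
    show "real (card ?E) \<le> (2 * real (card (edges G))) ^ Suc 0"
      unfolding card_S using sum_card_inner_walks_le[of 0] by simp
    show "real (card ?S) \<le> (2 * real (card (edges G))) ^ Suc j"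
      unfolding card_S by (rule sum_card_inner_walks_le)
  qed auto
  finally show ?thesis by simp
qed

lemma subgraph_count_cycle_bound:
  assumes "g \<ge> 3" "g \<noteq> 4"
  shows "real (subgraph_count G (cycle_graph g))
    \<le> 2 * sqrt (48 * real (subgraph_count G (cycle_graph 4)) * (2 * real (card (edges G))) ^ (g - 2))
      + sqrt ((2 * real (card (edges G))) ^ (g - 1))"
proof -
  let ?m = "card (edges G)"
  let ?b = "sqrt (48 * real (subgraph_count G (cycle_graph 4)) * (2 * real ?m) ^ (g - 2))"
  have rich0: "real (card (rich_cycle_lists 0 g)) \<le> ?b"
    using assms(1) by (rule card_rich_cycle_lists_0_le)
  have fin: "finite (rich_cycle_lists i g)" for i
    using finite_cycle_lists by (auto simp: rich_cycle_lists_def)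
  have "real (card (cycle_lists G g)) \<le> 2 * ?b + sqrt ((2 * real ?m) ^ (g - 1))"
  proof (cases "odd g")
    case True
    define j where "j = (g - 3) div 2"
    have g: "g = 2 * j + 3"
      using True assms unfolding j_def by presburger
    have "card (cycle_lists G g) \<le> card (cycle_lists G g - rich_cycle_lists 0 g) + card (rich_cycle_lists 0 g)"
      using diff_card_le_card_Diff[OF fin, of "cycle_lists G g" 0] by simp
    moreover have "real (card (cycle_lists G g - rich_cycle_lists 0 g)) \<le> sqrt ((2 * real ?m) ^ (g - 1))"
    proof -
      have "g - 1 = Suc j * 2" by (simp add: g)
      then have "((2 * real ?m) ^ Suc j)\<^sup>2 = (2 * real ?m) ^ (g - 1)"
        by (simp only: power_mult)
      then have "sqrt ((2 * real ?m) ^ (g - 1)) = (2 * real ?m) ^ Suc j"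
        by (rule real_sqrt_unique) simp
      then show ?thesis
        using card_poor_cycle_lists_odd_le[of j] by (simp only: g)
    qed
    moreover have "0 \<le> ?b" by simp
    ultimately show ?thesis using rich0 by linarith
  next
    case False
    define j where "j = (g - 6) div 2"
    have g: "g = 2 * j + 6"
      \<comment> \<open>here \<open>g \<noteq> 4\<close> is used: a 4-cycle has no second pair \<open>(x\<^sub>3, x\<^sub>5)\<close>\<close>
      using False assms unfolding j_def by presburger
    let ?P = "cycle_lists G g - rich_cycle_lists 0 g - rich_cycle_lists 3 g"
    have "card (cycle_lists G g) \<le> card (cycle_lists G g - rich_cycle_lists 0 g) + card (rich_cycle_lists 0 g)"
      using diff_card_le_card_Diff[OF fin, of "cycle_lists G g" 0] by simp
    moreover have "card (cycle_lists G g - rich_cycle_lists 0 g) \<le> card ?P + card (rich_cycle_lists 3 g)"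
      using diff_card_le_card_Diff[OF fin, of "cycle_lists G g - rich_cycle_lists 0 g" 3] by simp
    moreover have "card (rich_cycle_lists 3 g) \<le> card (rich_cycle_lists 0 g)"
      by (rule card_rich_cycle_lists_3_le) (simp add: g)
    \<comment> \<open>the bound $(2m)^{(g-2)/2}$ is relaxed to the one for odd \<open>g\<close>\<close>
    moreover have "real (card ?P) \<le> sqrt ((2 * real ?m) ^ (g - 1))"
    proof -
      have "g - 1 = Suc ((j + 2) * 2)" by (simp add: g)
      then have "(2 * real ?m) ^ (g - 1) = 2 * real ?m * ((2 * real ?m) ^ (j + 2))\<^sup>2"
        by (simp only: power_mult power_Suc)
      moreover have "1 * ((2 * real ?m) ^ (j + 2))\<^sup>2 \<le> 2 * real ?m * ((2 * real ?m) ^ (j + 2))\<^sup>2"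
        by (cases "?m = 0") (auto intro!: mult_right_mono)
      ultimately have "((2 * real ?m) ^ (j + 2))\<^sup>2 \<le> (2 * real ?m) ^ (g - 1)"
        by (simp only: mult_1)
      then have "(2 * real ?m) ^ (j + 2) \<le> sqrt ((2 * real ?m) ^ (g - 1))"
        by (rule real_le_rsqrt)
      then show ?thesis
        using card_poor_cycle_lists_even_le[of j] unfolding g by linarith
    qed
    ultimately show ?thesis using rich0 by linarith
  qed
  then show ?thesis
    using subgraph_count_cycle_le[of g] assms(1) by linarith
qed

end

section \<open>Convergence in probability\<close>

text \<open>
  The thresholds do not depend on the graph, so that this can be applied at every point of the
  probability spaces.
\<close>
lemma cycle_ratio_small:
  fixes \<epsilon> :: real
  assumes "g \<ge> 3" "g \<noteq> 4" "\<epsilon> > 0"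
  shows "\<exists>\<delta>>0. \<exists>K\<ge>0. \<forall>G :: 'v graph. finite_simple_graph G \<longrightarrow> real (card (edges G)) > K \<longrightarrow>
           real (subgraph_count G (cycle_graph 4)) / real (card (edges G)) ^ 2 \<le> \<delta> \<longrightarrow>
           real (subgraph_count G (cycle_graph g)) / real (card (edges G)) powr (real g / 2) \<le> \<epsilon>"
proof -
  \<comment> \<open>the two terms of the bound shall contribute \<open>2 * (\<epsilon> / 4)\<close> and \<open>\<epsilon> / 2\<close>\<close>
  define \<delta> where "\<delta> = (\<epsilon> / 4)\<^sup>2 / (48 * 2 ^ (g - 2))"
  define K where "K = 2 ^ (g - 1) / (\<epsilon> / 2)\<^sup>2"
  have "\<delta> > 0" "K \<ge> 0" using assms by (auto simp: \<delta>_def K_def)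
  moreover have "real (subgraph_count G (cycle_graph g)) / real (card (edges G)) powr (real g / 2) \<le> \<epsilon>"
    if "finite_simple_graph G" and mK: "real (card (edges G)) > K"
      and N4: "real (subgraph_count G (cycle_graph 4)) / real (card (edges G)) ^ 2 \<le> \<delta>"
    for G :: "'v graph"
  proof -
    interpret finite_simple_graph G by fact
    define m where "m = real (card (edges G))"
    define N where "N = real (subgraph_count G (cycle_graph 4))"
    have m: "m > 0" using mK \<open>K \<ge> 0\<close> by (simp add: m_def)
    have powr_eq: "m powr (real g / 2) = sqrt (m ^ g)"
      using m by (simp add: powr_half_sqrt[symmetric] powr_realpow[symmetric] powr_powr)
    have "sqrt (48 * N * (2 * m) ^ (g - 2)) / sqrt (m ^ g) \<le> \<epsilon> / 4"
    proof -
      have "2 + (g - 2) = g" using assms by simp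
      then have "m ^ g = m\<^sup>2 * m ^ (g - 2)"
        by (metis power_add)
      then have "48 * N * (2 * m) ^ (g - 2) / m ^ g = 48 * 2 ^ (g - 2) * (N / m\<^sup>2)"
        using m by (simp add: power_mult_distrib)
      also have "\<dots> \<le> 48 * 2 ^ (g - 2) * \<delta>"
        using N4 by (intro mult_left_mono) (auto simp: N_def m_def)
      also have "\<dots> = (\<epsilon> / 4)\<^sup>2" by (simp add: \<delta>_def)
      finally show ?thesis
        using assms(3) by (simp only: real_sqrt_divide[symmetric]) (rule real_le_lsqrt; simp)
    qed
    moreover have "sqrt ((2 * m) ^ (g - 1)) / sqrt (m ^ g) \<le> \<epsilon> / 2"
    proof -
      have "m ^ g = m * m ^ (g - 1)"
        using assms by (simp add: power_Suc[symmetric] del: power_Suc)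
      then have "(2 * m) ^ (g - 1) / m ^ g = 2 ^ (g - 1) / m"
        using m by (simp add: power_mult_distrib)
      also have "\<dots> \<le> (\<epsilon> / 2)\<^sup>2"
        using mK m assms(3) by (simp add: K_def m_def field_simps)
      finally show ?thesis
        using assms(3) by (simp only: real_sqrt_divide[symmetric]) (rule real_le_lsqrt; simp)
    qed
    moreover have "real (subgraph_count G (cycle_graph g)) / sqrt (m ^ g)
        \<le> (2 * sqrt (48 * N * (2 * m) ^ (g - 2)) + sqrt ((2 * m) ^ (g - 1))) / sqrt (m ^ g)"
      using subgraph_count_cycle_bound[OF assms(1,2)] m
      unfolding m_def N_def by (intro divide_right_mono) auto
    ultimately show ?thesis
      unfolding m_def[symmetric] powr_eq add_divide_distrib times_divide_eq_right[symmetric]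
      by linarith
  qed
  ultimately show ?thesis by blast
qed

text \<open>
  The event that \<open>X\<close> is large lies in the union of the events that \<open>Y\<close> is large and that \<open>Z\<close>
  is small.
\<close>
lemma tendsto_zero_in_prob_transfer:
  assumes prob: "\<And>n. n \<ge> 1 \<Longrightarrow> prob_space (M n)"
    and meas_Y: "\<And>n. n \<ge> 1 \<Longrightarrow> Y n \<in> borel_measurable (M n)"
    and meas_Z: "\<And>n. n \<ge> 1 \<Longrightarrow> Z n \<in> borel_measurable (M n)"
    and Y: "tendsto_zero_in_prob M Y" and Z: "tendsto_infinity_in_prob M Z"
    and dom: "\<And>\<epsilon>. \<epsilon> > 0 \<Longrightarrow> \<exists>\<delta>>0. \<exists>K. \<forall>n\<ge>1. \<forall>\<omega>\<in>space (M n).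
                Z n \<omega> > K \<longrightarrow> \<bar>Y n \<omega>\<bar> \<le> \<delta> \<longrightarrow> \<bar>X n \<omega>\<bar> \<le> \<epsilon>"
  shows "tendsto_zero_in_prob M X"
  unfolding tendsto_zero_in_prob_def
proof (intro allI impI)
  fix \<epsilon> :: real assume "\<epsilon> > 0"
  from dom[OF this] obtain \<delta> K where \<delta>: "\<delta> > 0"
    and D: "\<And>n \<omega>. n \<ge> 1 \<Longrightarrow> \<omega> \<in> space (M n) \<Longrightarrow> Z n \<omega> > K \<Longrightarrow> \<bar>Y n \<omega>\<bar> \<le> \<delta> \<Longrightarrow> \<bar>X n \<omega>\<bar> \<le> \<epsilon>"
    by blast
  let ?x = "\<lambda>n. measure (M n) {\<omega> \<in> space (M n). \<bar>X n \<omega>\<bar> > \<epsilon>}"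
  let ?y = "\<lambda>n. measure (M n) {\<omega> \<in> space (M n). \<bar>Y n \<omega>\<bar> > \<delta>}"
  let ?z = "\<lambda>n. measure (M n) {\<omega> \<in> space (M n). Z n \<omega> > K}"
  have bound: "?x n \<le> ?y n + (1 - ?z n)" if n: "n \<ge> 1" for n
  proof -
    interpret prob_space "M n" by (rule prob[OF n])
    note [measurable] = meas_Y[OF n] meas_Z[OF n]
    have A: "{\<omega> \<in> space (M n). \<bar>Y n \<omega>\<bar> > \<delta>} \<in> events" by measurable
    have B: "{\<omega> \<in> space (M n). Z n \<omega> > K} \<in> events" by measurable
    have "{\<omega> \<in> space (M n). \<bar>X n \<omega>\<bar> > \<epsilon>}
        \<subseteq> {\<omega> \<in> space (M n). \<bar>Y n \<omega>\<bar> > \<delta>} \<union> (space (M n) - {\<omega> \<in> space (M n). Z n \<omega> > K})"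
      using D[OF n] by (auto simp: not_less[symmetric])
    then have "?x n \<le> prob ({\<omega> \<in> space (M n). \<bar>Y n \<omega>\<bar> > \<delta>} \<union> (space (M n) - {\<omega> \<in> space (M n). Z n \<omega> > K}))"
      using A B by (intro finite_measure_mono) auto
    also have "\<dots> \<le> ?y n + prob (space (M n) - {\<omega> \<in> space (M n). Z n \<omega> > K})"
      using A B by (intro measure_Un_le) auto
    also have "\<dots> = ?y n + (1 - ?z n)"
      by (subst prob_compl[OF B]) (rule refl)
    finally show ?thesis .
  qed
  have lim: "(\<lambda>n. ?y n + (1 - ?z n)) \<longlonglongrightarrow> 0 + (1 - 1)"
    using Y Z \<delta> unfolding tendsto_zero_in_prob_def tendsto_infinity_in_prob_def
    by (intro tendsto_intros) auto
  show "?x \<longlonglongrightarrow> 0"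
  proof (rule tendsto_sandwich)
    show "\<forall>\<^sub>F n in sequentially. 0 \<le> ?x n" by simp
    show "\<forall>\<^sub>F n in sequentially. ?x n \<le> ?y n + (1 - ?z n)"
      using eventually_ge_at_top[of 1] by eventually_elim (rule bound)
    show "(\<lambda>n. ?y n + (1 - ?z n)) \<longlonglongrightarrow> 0" using lim by simp
  qed simp
qed

theorem theorem6p1:
  fixes M :: "nat \<Rightarrow> 'a measure" and G :: "nat \<Rightarrow> 'a \<Rightarrow> nat graph"
  assumes prob: "\<And>n. n \<ge> 1 \<Longrightarrow> prob_space (M n)"
    and random_graph: "\<And>n. n \<ge> 1 \<Longrightarrow> G n \<in> measurable (M n) (count_space (graphs_on {1..n}))"
    and many_edges: "tendsto_infinity_in_prob M (\<lambda>n \<omega>. real (card (edges (G n \<omega>))))"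
  shows "small_oP M (\<lambda>n \<omega>. real (subgraph_count (G n \<omega>) (cycle_graph 4)))
             (\<lambda>n \<omega>. real (card (edges (G n \<omega>))) ^ 2)
     \<longleftrightarrow> (\<forall>g\<ge>3. small_oP M (\<lambda>n \<omega>. real (subgraph_count (G n \<omega>) (cycle_graph g)))
             (\<lambda>n \<omega>. real (card (edges (G n \<omega>))) powr (real g / 2)))"
proof
  assume C4: "small_oP M (\<lambda>n \<omega>. real (subgraph_count (G n \<omega>) (cycle_graph 4)))
             (\<lambda>n \<omega>. real (card (edges (G n \<omega>))) ^ 2)"
  show "\<forall>g\<ge>3. small_oP M (\<lambda>n \<omega>. real (subgraph_count (G n \<omega>) (cycle_graph g)))
             (\<lambda>n \<omega>. real (card (edges (G n \<omega>))) powr (real g / 2))"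
  proof (intro allI impI)
    fix g :: nat assume g: "g \<ge> 3"
    have meas: "(\<lambda>\<omega>. f (G n \<omega>)) \<in> borel_measurable (M n)" if "n \<ge> 1" for n and f :: "nat graph \<Rightarrow> real"
      by (rule measurable_compose[OF random_graph[OF that]]) (simp add: measurable_count_space_eq1)
    have fsg: "finite_simple_graph (G n \<omega>)" if "n \<ge> 1" "\<omega> \<in> space (M n)" for n \<omega>
      using measurable_space[OF random_graph[OF that(1)] that(2)]
      by unfold_locales (auto simp: graphs_on_def)
    show "small_oP M (\<lambda>n \<omega>. real (subgraph_count (G n \<omega>) (cycle_graph g)))
             (\<lambda>n \<omega>. real (card (edges (G n \<omega>))) powr (real g / 2))"
    proof (cases "g = 4")
      case True
      then show ?thesis using C4 by simp
    next
      case False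
      show ?thesis
        unfolding small_oP_def
      proof (rule tendsto_zero_in_prob_transfer[OF prob
            meas[where f = "\<lambda>H. real (subgraph_count H (cycle_graph 4)) / real (card (edges H)) ^ 2"]
            meas[where f = "\<lambda>H. real (card (edges H))"]
            C4[unfolded small_oP_def] many_edges])
        fix \<epsilon> :: real assume "\<epsilon> > 0"
        from cycle_ratio_small[OF g False this, where 'v = nat]
        obtain \<delta> K where "\<delta> > 0"
          and "\<And>H :: nat graph. finite_simple_graph H \<Longrightarrow> real (card (edges H)) > K \<Longrightarrow>
            real (subgraph_count H (cycle_graph 4)) / real (card (edges H)) ^ 2 \<le> \<delta> \<Longrightarrow>
            real (subgraph_count H (cycle_graph g)) / real (card (edges H)) powr (real g / 2) \<le> \<epsilon>"
          by blast
        then show "\<exists>\<delta>>0. \<exists>K. \<forall>n\<ge>1. \<forall>\<omega>\<in>space (M n). real (card (edges (G n \<omega>))) > K \<longrightarrow>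
            \<bar>real (subgraph_count (G n \<omega>) (cycle_graph 4)) / real (card (edges (G n \<omega>))) ^ 2\<bar> \<le> \<delta> \<longrightarrow>
            \<bar>real (subgraph_count (G n \<omega>) (cycle_graph g)) / real (card (edges (G n \<omega>))) powr (real g / 2)\<bar> \<le> \<epsilon>"
          using fsg by (intro exI[of _ \<delta>] conjI exI[of _ K]) auto
      qed
    qed
  qed
next
  assume "\<forall>g\<ge>3. small_oP M (\<lambda>n \<omega>. real (subgraph_count (G n \<omega>) (cycle_graph g)))
             (\<lambda>n \<omega>. real (card (edges (G n \<omega>))) powr (real g / 2))"
  then have "small_oP M (\<lambda>n \<omega>. real (subgraph_count (G n \<omega>) (cycle_graph 4)))
             (\<lambda>n \<omega>. real (card (edges (G n \<omega>))) powr (real 4 / 2))"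
    by (rule allE[of _ 4]) simp
  then show "small_oP M (\<lambda>n \<omega>. real (subgraph_count (G n \<omega>) (cycle_graph 4)))
             (\<lambda>n \<omega>. real (card (edges (G n \<omega>))) ^ 2)"
    by simp
qed

end
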